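(* Let $B$ be a unital ring and $R$ a $B$-ring (without unit). Let $\mathcal M$ be a full subcategory of $\widetilde{\mathcal M}_R$. Then $R$ has (right) local units on all $M\in\mathcal M$ if and only if there exists a full subcategory $\mathcal N$ of the category of right $B$-modules such that every $M\in\mathcal M$ is generated by objects of $\mathcal N$ as a right $B$-module and, for all $N\in\mathcal N$, $M\in\mathcal M$ and $f\in\mathrm{Hom}_B(N,M)$, there exists $e\in R^B\cong{}_B\mathrm{Hom}_B(B,R)$ such that $f=f_e\circ f$, where $f_e:M\to M$, $f_e(m)=m\cdot e$ (i.e. $f_e$ is the composite $M\cong M\otimes_B B\xrightarrow{M\otimes_B e}M\otimes_B R\xrightarrow{\mu_M}M$).
   Context: A non-unital $B$-ring $R$ is a $B$-bimodule with an associative $B$-bilinear multiplication $R\otimes_B R\to R$. $\widetilde{\mathcal M}_R$ is the category of right $R$-modules: right $B$-modules $M$ with an associative right $B$-linear multiplication map $\mu_M:M\otimes_B R\to M$, written $m\cdot r$. $R^B=\{r\in R\mid br=rb\ \forall b\in B\}$. $R$ has right local units on $M$ if for every finitely generated right $B$-submodule $N\subset M$ there is $e\in R^B$ with $n\cdot e=n$ for all $n\in N$. "$M$ is generated by objects of $\mathcal N$" means there is a surjective right $B$-linear map $\coprod_{i}N_i\to M$ from a direct sum of objects $N_i\in\mathcal N$. *)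

theory Defs
  imports "HOL.Hull" "HOL-Algebra.Module" "HOL-Algebra.AbelCoset"
begin

text \<open>
  Following HOL-Algebra's \<^typ>\<open>('a, 'b) module\<close>, the module records extend the record
  of rings; the fields \<^const>\<open>mult\<close> and \<^const>\<open>one\<close> are unused unless stated otherwise.
\<close>

record ('b, 'm) rmod = "'m ring" +
  rsmult :: "['m, 'b] \<Rightarrow> 'm" (infixl "\<triangleleft>\<index>" 70)

locale right_module = B?: ring B + M?: abelian_group M
  for B :: "('b, 'x) ring_scheme" and M :: "('b, 'm, 'y) rmod_scheme" +
  assumes rsmult_closed:
      "\<lbrakk>m \<in> carrier M; b \<in> carrier B\<rbrakk> \<Longrightarrow> m \<triangleleft>\<^bsub>M\<^esub> b \<in> carrier M"
    and rsmult_add_left: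
      "\<lbrakk>m \<in> carrier M; n \<in> carrier M; b \<in> carrier B\<rbrakk>
        \<Longrightarrow> (m \<oplus>\<^bsub>M\<^esub> n) \<triangleleft>\<^bsub>M\<^esub> b = m \<triangleleft>\<^bsub>M\<^esub> b \<oplus>\<^bsub>M\<^esub> n \<triangleleft>\<^bsub>M\<^esub> b"
    and rsmult_add_right:
      "\<lbrakk>m \<in> carrier M; b \<in> carrier B; c \<in> carrier B\<rbrakk>
        \<Longrightarrow> m \<triangleleft>\<^bsub>M\<^esub> (b \<oplus>\<^bsub>B\<^esub> c) = m \<triangleleft>\<^bsub>M\<^esub> b \<oplus>\<^bsub>M\<^esub> m \<triangleleft>\<^bsub>M\<^esub> c"
    and rsmult_assoc:
      "\<lbrakk>m \<in> carrier M; b \<in> carrier B; c \<in> carrier B\<rbrakk>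
        \<Longrightarrow> m \<triangleleft>\<^bsub>M\<^esub> (b \<otimes>\<^bsub>B\<^esub> c) = (m \<triangleleft>\<^bsub>M\<^esub> b) \<triangleleft>\<^bsub>M\<^esub> c"
    and rsmult_one: "m \<in> carrier M \<Longrightarrow> m \<triangleleft>\<^bsub>M\<^esub> \<one>\<^bsub>B\<^esub> = m"

text \<open>The field \<^const>\<open>mult\<close> is the multiplication of the non-unital \<open>B\<close>-ring.\<close>

record ('b, 'r) bring = "('b, 'r) rmod" +
  lsmult :: "['b, 'r] \<Rightarrow> 'r" (infixr "\<triangleright>\<index>" 70)

locale bimodule = right_module B R
  for B :: "('b, 'x) ring_scheme" and R :: "('b, 'r, 'y) bring_scheme" +
  assumes lsmult_closed:
      "\<lbrakk>b \<in> carrier B; r \<in> carrier R\<rbrakk> \<Longrightarrow> b \<triangleright>\<^bsub>R\<^esub> r \<in> carrier R"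
    and lsmult_add_right:
      "\<lbrakk>b \<in> carrier B; r \<in> carrier R; s \<in> carrier R\<rbrakk>
        \<Longrightarrow> b \<triangleright>\<^bsub>R\<^esub> (r \<oplus>\<^bsub>R\<^esub> s) = (b \<triangleright>\<^bsub>R\<^esub> r) \<oplus>\<^bsub>R\<^esub> (b \<triangleright>\<^bsub>R\<^esub> s)"
    and lsmult_add_left:
      "\<lbrakk>b \<in> carrier B; c \<in> carrier B; r \<in> carrier R\<rbrakk>
        \<Longrightarrow> (b \<oplus>\<^bsub>B\<^esub> c) \<triangleright>\<^bsub>R\<^esub> r = (b \<triangleright>\<^bsub>R\<^esub> r) \<oplus>\<^bsub>R\<^esub> (c \<triangleright>\<^bsub>R\<^esub> r)"
    and lsmult_assoc:
      "\<lbrakk>b \<in> carrier B; c \<in> carrier B; r \<in> carrier R\<rbrakk>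
        \<Longrightarrow> (b \<otimes>\<^bsub>B\<^esub> c) \<triangleright>\<^bsub>R\<^esub> r = b \<triangleright>\<^bsub>R\<^esub> (c \<triangleright>\<^bsub>R\<^esub> r)"
    and lsmult_one: "r \<in> carrier R \<Longrightarrow> \<one>\<^bsub>B\<^esub> \<triangleright>\<^bsub>R\<^esub> r = r"
    and lsmult_rsmult:
      "\<lbrakk>b \<in> carrier B; r \<in> carrier R; c \<in> carrier B\<rbrakk>
        \<Longrightarrow> (b \<triangleright>\<^bsub>R\<^esub> r) \<triangleleft>\<^bsub>R\<^esub> c = b \<triangleright>\<^bsub>R\<^esub> (r \<triangleleft>\<^bsub>R\<^esub> c)"

text \<open>
  A homomorphism \<open>\<mu>\<close> out of a tensor product \<open>M \<otimes>\<^sub>B R\<close> is given by its values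
  \<open>m \<cdot> r = \<mu> (m \<otimes> r)\<close>, that is, by a map on pairs that is additive in each argument and
  \<open>B\<close>-balanced, \<open>(m b) \<cdot> r = m \<cdot> (b r)\<close>.  The multiplication of \<open>R\<close> and the action of \<open>R\<close>
  on \<open>M\<close> are recorded in this form; neither is assumed to have a unit.
\<close>

locale nonunital_B_ring = bimodule B R
  for B :: "('b, 'x) ring_scheme" and R :: "('b, 'r, 'y) bring_scheme" +
  assumes mult_closed:
      "\<lbrakk>r \<in> carrier R; s \<in> carrier R\<rbrakk> \<Longrightarrow> r \<otimes>\<^bsub>R\<^esub> s \<in> carrier R"
    and mult_add_left:
      "\<lbrakk>r \<in> carrier R; s \<in> carrier R; t \<in> carrier R\<rbrakk>
        \<Longrightarrow> (r \<oplus>\<^bsub>R\<^esub> s) \<otimes>\<^bsub>R\<^esub> t = r \<otimes>\<^bsub>R\<^esub> t \<oplus>\<^bsub>R\<^esub> s \<otimes>\<^bsub>R\<^esub> t"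
    and mult_add_right:
      "\<lbrakk>r \<in> carrier R; s \<in> carrier R; t \<in> carrier R\<rbrakk>
        \<Longrightarrow> r \<otimes>\<^bsub>R\<^esub> (s \<oplus>\<^bsub>R\<^esub> t) = r \<otimes>\<^bsub>R\<^esub> s \<oplus>\<^bsub>R\<^esub> r \<otimes>\<^bsub>R\<^esub> t"
    and mult_balanced:
      "\<lbrakk>r \<in> carrier R; b \<in> carrier B; s \<in> carrier R\<rbrakk>
        \<Longrightarrow> (r \<triangleleft>\<^bsub>R\<^esub> b) \<otimes>\<^bsub>R\<^esub> s = r \<otimes>\<^bsub>R\<^esub> (b \<triangleright>\<^bsub>R\<^esub> s)"
    and mult_left_linear:
      "\<lbrakk>b \<in> carrier B; r \<in> carrier R; s \<in> carrier R\<rbrakk>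
        \<Longrightarrow> (b \<triangleright>\<^bsub>R\<^esub> r) \<otimes>\<^bsub>R\<^esub> s = b \<triangleright>\<^bsub>R\<^esub> (r \<otimes>\<^bsub>R\<^esub> s)"
    and mult_right_linear:
      "\<lbrakk>r \<in> carrier R; s \<in> carrier R; b \<in> carrier B\<rbrakk>
        \<Longrightarrow> r \<otimes>\<^bsub>R\<^esub> (s \<triangleleft>\<^bsub>R\<^esub> b) = (r \<otimes>\<^bsub>R\<^esub> s) \<triangleleft>\<^bsub>R\<^esub> b"
    and mult_assoc:
      "\<lbrakk>r \<in> carrier R; s \<in> carrier R; t \<in> carrier R\<rbrakk>
        \<Longrightarrow> (r \<otimes>\<^bsub>R\<^esub> s) \<otimes>\<^bsub>R\<^esub> t = r \<otimes>\<^bsub>R\<^esub> (s \<otimes>\<^bsub>R\<^esub> t)"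

record ('b, 'r, 'm) Rmod = "('b, 'm) rmod" +
  ract :: "['m, 'r] \<Rightarrow> 'm" (infixl "\<bullet>\<index>" 70)

locale right_R_module = R?: nonunital_B_ring B R + M?: right_module B M
  for B :: "('b, 'x) ring_scheme"
    and R :: "('b, 'r, 'y) bring_scheme"
    and M :: "('b, 'r, 'm, 'z) Rmod_scheme" +
  assumes ract_closed:
      "\<lbrakk>m \<in> carrier M; r \<in> carrier R\<rbrakk> \<Longrightarrow> m \<bullet>\<^bsub>M\<^esub> r \<in> carrier M"
    and ract_add_left:
      "\<lbrakk>m \<in> carrier M; n \<in> carrier M; r \<in> carrier R\<rbrakk>
        \<Longrightarrow> (m \<oplus>\<^bsub>M\<^esub> n) \<bullet>\<^bsub>M\<^esub> r = m \<bullet>\<^bsub>M\<^esub> r \<oplus>\<^bsub>M\<^esub> n \<bullet>\<^bsub>M\<^esub> r"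
    and ract_add_right:
      "\<lbrakk>m \<in> carrier M; r \<in> carrier R; s \<in> carrier R\<rbrakk>
        \<Longrightarrow> m \<bullet>\<^bsub>M\<^esub> (r \<oplus>\<^bsub>R\<^esub> s) = m \<bullet>\<^bsub>M\<^esub> r \<oplus>\<^bsub>M\<^esub> m \<bullet>\<^bsub>M\<^esub> s"
    and ract_balanced:
      "\<lbrakk>m \<in> carrier M; b \<in> carrier B; r \<in> carrier R\<rbrakk>
        \<Longrightarrow> (m \<triangleleft>\<^bsub>M\<^esub> b) \<bullet>\<^bsub>M\<^esub> r = m \<bullet>\<^bsub>M\<^esub> (b \<triangleright>\<^bsub>R\<^esub> r)"
    and ract_right_linear:
      "\<lbrakk>m \<in> carrier M; r \<in> carrier R; b \<in> carrier B\<rbrakk>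
        \<Longrightarrow> m \<bullet>\<^bsub>M\<^esub> (r \<triangleleft>\<^bsub>R\<^esub> b) = (m \<bullet>\<^bsub>M\<^esub> r) \<triangleleft>\<^bsub>M\<^esub> b"
    and ract_assoc:
      "\<lbrakk>m \<in> carrier M; r \<in> carrier R; s \<in> carrier R\<rbrakk>
        \<Longrightarrow> m \<bullet>\<^bsub>M\<^esub> (r \<otimes>\<^bsub>R\<^esub> s) = (m \<bullet>\<^bsub>M\<^esub> r) \<bullet>\<^bsub>M\<^esub> s"

definition centralizing_elements ::
    "('b, 'x) ring_scheme \<Rightarrow> ('b, 'r, 'y) bring_scheme \<Rightarrow> 'r set" where
  "centralizing_elements B R = {r \<in> carrier R. \<forall>b \<in> carrier B. b \<triangleright>\<^bsub>R\<^esub> r = r \<triangleleft>\<^bsub>R\<^esub> b}"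

definition right_submodule ::
    "('b, 'x) ring_scheme \<Rightarrow> ('b, 'm, 'y) rmod_scheme \<Rightarrow> 'm set \<Rightarrow> bool" where
  "right_submodule B M N \<longleftrightarrow>
     additive_subgroup N M \<and> (\<forall>n \<in> N. \<forall>b \<in> carrier B. n \<triangleleft>\<^bsub>M\<^esub> b \<in> N)"

definition fg_right_submodule ::
    "('b, 'x) ring_scheme \<Rightarrow> ('b, 'm, 'y) rmod_scheme \<Rightarrow> 'm set \<Rightarrow> bool" where
  "fg_right_submodule B M N \<longleftrightarrow>
     (\<exists>S. finite S \<and> S \<subseteq> carrier M \<and> N = right_submodule B M hull S)"

definition has_right_local_units ::
    "('b, 'x) ring_scheme \<Rightarrow> ('b, 'r, 'y) bring_scheme \<Rightarrow> ('b, 'r, 'm, 'z) Rmod_scheme \<Rightarrow> bool" where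
  "has_right_local_units B R M \<longleftrightarrow>
     (\<forall>N. fg_right_submodule B M N \<longrightarrow>
        (\<exists>e \<in> centralizing_elements B R. \<forall>n \<in> N. n \<bullet>\<^bsub>M\<^esub> e = n))"

text \<open>Homomorphisms are extensional, so that their equality is equality on the carrier.\<close>

definition rmod_Hom ::
    "('b, 'x) ring_scheme \<Rightarrow> ('b, 'n, 'y) rmod_scheme \<Rightarrow> ('b, 'm, 'z) rmod_scheme \<Rightarrow> ('n \<Rightarrow> 'm) set" where
  "rmod_Hom B N M =
     {f \<in> hom (add_monoid N) (add_monoid M) \<inter> extensional (carrier N).
        \<forall>n \<in> carrier N. \<forall>b \<in> carrier B. f (n \<triangleleft>\<^bsub>N\<^esub> b) = f n \<triangleleft>\<^bsub>M\<^esub> b}"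

definition right_mult_map :: "('b, 'r, 'm, 'z) Rmod_scheme \<Rightarrow> 'r \<Rightarrow> 'm \<Rightarrow> 'm" where
  "right_mult_map M e = (\<lambda>m \<in> carrier M. m \<bullet>\<^bsub>M\<^esub> e)"

definition rmod_direct_sum :: "'i set \<Rightarrow> ('i \<Rightarrow> ('b, 'n) rmod) \<Rightarrow> ('b, 'i \<Rightarrow> 'n) rmod" where
  "rmod_direct_sum I F =
     \<lparr>carrier = {x \<in> \<Pi>\<^sub>E i\<in>I. carrier (F i). finite {i \<in> I. x i \<noteq> \<zero>\<^bsub>F i\<^esub>}},
      mult = undefined, one = undefined,
      zero = (\<lambda>i\<in>I. \<zero>\<^bsub>F i\<^esub>),
      add = (\<lambda>x y. \<lambda>i\<in>I. x i \<oplus>\<^bsub>F i\<^esub> y i),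
      rsmult = (\<lambda>x b. \<lambda>i\<in>I. x i \<triangleleft>\<^bsub>F i\<^esub> b)\<rparr>"

definition surjection_from_direct_sum ::
    "('b, 'x) ring_scheme \<Rightarrow> ('b, 'n) rmod set \<Rightarrow> ('b, 'm, 'y) rmod_scheme \<Rightarrow>
     'i set \<Rightarrow> ('i \<Rightarrow> ('b, 'n) rmod) \<Rightarrow> (('i \<Rightarrow> 'n) \<Rightarrow> 'm) \<Rightarrow> bool" where
  "surjection_from_direct_sum B \<N> M I F g \<longleftrightarrow>
     (\<forall>i\<in>I. F i \<in> \<N>) \<and> g \<in> rmod_Hom B (rmod_direct_sum I F) M \<and>
     g ` carrier (rmod_direct_sum I F) = carrier M"

text \<open>
  An existential quantifier cannot range over types, so the type of the index set has to be
  fixed.  The type of pairs of a module and a map is large enough for this to be no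
  restriction: see \<open>generated_by_any_index\<close> below.

  A full subcategory is given by its set of objects.  The carrier type of the modules plays
  the role of a universe, so subcategories of the \<open>R\<close>-modules and of the \<open>B\<close>-modules that
  occur together share it.
\<close>

definition generated_by ::
    "('b, 'x) ring_scheme \<Rightarrow> ('b, 'n) rmod set \<Rightarrow> ('b, 'm, 'y) rmod_scheme \<Rightarrow> bool" where
  "generated_by B \<N> M \<longleftrightarrow>
     (\<exists>(I :: (('b, 'n) rmod \<times> ('n \<Rightarrow> 'm)) set) F g. surjection_from_direct_sum B \<N> M I F g)"

lemma surjection_from_direct_sum_reindex:
  fixes I :: "'i set" and F :: "'i \<Rightarrow> ('b, 'n) rmod"
    and p :: "'i \<Rightarrow> 'k" and F' :: "'k \<Rightarrow> ('b, 'n) rmod"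
    and B :: "('b, 'x) ring_scheme" and M :: "('b, 'm, 'y) rmod_scheme"
  assumes \<N>: "\<forall>N \<in> \<N>. right_module B N" and M: "right_module B M"
    and surj: "surjection_from_direct_sum B \<N> M I F g"
    and Fp: "\<And>i. i \<in> I \<Longrightarrow> F' (p i) = F i"
    and gp: "\<And>i j a. \<lbrakk>i \<in> I; j \<in> I; p i = p j; a \<in> carrier (F i)\<rbrakk> \<Longrightarrow>
        g (\<lambda>k\<in>I. if k = i then a else \<zero>\<^bsub>F k\<^esub>) =
        g (\<lambda>k\<in>I. if k = j then a else \<zero>\<^bsub>F k\<^esub>)"
  shows "\<exists>h. surjection_from_direct_sum B \<N> M (p ` I) F' h"
proof -
  let ?S = "rmod_direct_sum I F"
  have FN: "F i \<in> \<N>" if "i \<in> I" for i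
    using surj that by (simp add: surjection_from_direct_sum_def)
  have RF: "right_module B (F i)" if "i \<in> I" for i
    using FN \<N> that by blast
  have AG: "abelian_group (F i)" if "i \<in> I" for i
    using RF[OF that] by (simp add: right_module_def)
  interpret M: right_module B M by (rule M)
  have g_add: "g (add ?S x y) = g x \<oplus>\<^bsub>M\<^esub> g y"
    if "x \<in> carrier ?S" "y \<in> carrier ?S" for x y
    using surj that by (auto simp: surjection_from_direct_sum_def rmod_Hom_def hom_def)
  have g_closed: "g x \<in> carrier M" if "x \<in> carrier ?S" for x
    using surj that by (auto simp: surjection_from_direct_sum_def rmod_Hom_def hom_def)
  have g_smult: "g (rsmult ?S x b) = g x \<triangleleft>\<^bsub>M\<^esub> b"
    if "x \<in> carrier ?S" "b \<in> carrier B" for x b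
    using surj that by (auto simp: surjection_from_direct_sum_def rmod_Hom_def)
  have g_surj: "g ` carrier ?S = carrier M"
    using surj by (simp add: surjection_from_direct_sum_def)
  define inj where "inj i a = (\<lambda>j\<in>I. if j = i then a else \<zero>\<^bsub>F j\<^esub>)" for i a
  have inj_carrier: "inj i a \<in> carrier ?S" if "i \<in> I" "a \<in> carrier (F i)" for i a
  proof -
    have "{j \<in> I. inj i a j \<noteq> \<zero>\<^bsub>F j\<^esub>} \<subseteq> {i}"
      by (auto simp: inj_def)
    then have "finite {j \<in> I. inj i a j \<noteq> \<zero>\<^bsub>F j\<^esub>}"
      by (rule finite_subset) simp
    then show ?thesis
      using that AG by (auto simp: rmod_direct_sum_def inj_def PiE_def abelian_groupE(2))
  qed
  define I' where "I' = p ` I"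
  define r where "r = inv_into I p"
  have r: "r k \<in> I" "p (r k) = k" if "k \<in> I'" for k
    using that unfolding r_def I'_def by (auto intro: inv_into_into f_inv_into_f)
  have Fr: "F (r k) = F' k" if "k \<in> I'" for k
    using Fp[OF r(1)[OF that]] r(2)[OF that] by simp
  let ?S' = "rmod_direct_sum I' F'"
  define ext where
    "ext y = (\<lambda>i\<in>I. if i \<in> r ` I' then y (p i) else \<zero>\<^bsub>F i\<^esub>)" for y :: "_ \<Rightarrow> 'n"
  have pI: "p i \<in> I'" if "i \<in> I" for i using that by (simp add: I'_def)
  have ext_carrier: "ext y \<in> carrier ?S" if y: "y \<in> carrier ?S'" for y
  proof -
    have yk: "y k \<in> carrier (F' k)" if "k \<in> I'" for k
      using y that by (auto simp: rmod_direct_sum_def)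
    have "{i \<in> I. ext y i \<noteq> \<zero>\<^bsub>F i\<^esub>} \<subseteq> r ` {k \<in> I'. y k \<noteq> \<zero>\<^bsub>F' k\<^esub>}"
      using r by (auto simp: ext_def Fr)
    moreover have "finite {k \<in> I'. y k \<noteq> \<zero>\<^bsub>F' k\<^esub>}"
      using y by (simp add: rmod_direct_sum_def)
    ultimately have "finite {i \<in> I. ext y i \<noteq> \<zero>\<^bsub>F i\<^esub>}"
      by (meson finite_imageI finite_subset)
    moreover have "ext y i \<in> carrier (F i)" if "i \<in> I" for i
      using that yk[OF pI[OF that]] abelian_groupE(2)[OF AG[OF that]] by (simp add: ext_def Fp)
    ultimately show ?thesis
      by (auto simp: rmod_direct_sum_def PiE_def ext_def)
  qed
  have add_closed: "add ?S' x y \<in> carrier ?S'"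
    if x: "x \<in> carrier ?S'" and y: "y \<in> carrier ?S'" for x y
  proof -
    have c: "x k \<in> carrier (F' k)" "y k \<in> carrier (F' k)" if "k \<in> I'" for k
      using x y that by (auto simp: rmod_direct_sum_def)
    have a: "abelian_group (F' k)" if "k \<in> I'" for k
      using AG[OF r(1)[OF that]] Fr[OF that] by simp
    have "{k \<in> I'. x k \<oplus>\<^bsub>F' k\<^esub> y k \<noteq> \<zero>\<^bsub>F' k\<^esub>}
        \<subseteq> {k \<in> I'. x k \<noteq> \<zero>\<^bsub>F' k\<^esub>} \<union> {k \<in> I'. y k \<noteq> \<zero>\<^bsub>F' k\<^esub>}"
      using a by (auto simp: abelian_groupE(2,5))
    moreover have "finite ({k \<in> I'. x k \<noteq> \<zero>\<^bsub>F' k\<^esub>} \<union> {k \<in> I'. y k \<noteq> \<zero>\<^bsub>F' k\<^esub>})"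
      using x y by (simp add: rmod_direct_sum_def)
    ultimately have "finite {k \<in> I'. x k \<oplus>\<^bsub>F' k\<^esub> y k \<noteq> \<zero>\<^bsub>F' k\<^esub>}"
      by (rule finite_subset)
    moreover have "{k \<in> I'. (\<lambda>k\<in>I'. x k \<oplus>\<^bsub>F' k\<^esub> y k) k \<noteq> \<zero>\<^bsub>F' k\<^esub>} =
        {k \<in> I'. x k \<oplus>\<^bsub>F' k\<^esub> y k \<noteq> \<zero>\<^bsub>F' k\<^esub>}"
      by auto
    ultimately show ?thesis
      using c a by (auto simp: rmod_direct_sum_def abelian_groupE(1))
  qed
  have zero_smult: "\<zero>\<^bsub>N\<^esub> \<triangleleft>\<^bsub>N\<^esub> b = \<zero>\<^bsub>N\<^esub>"
    if "right_module B N" "b \<in> carrier B" for N :: "('b, 'n) rmod" and b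
  proof -
    interpret N: right_module B N by (rule that)
    have "\<zero>\<^bsub>N\<^esub> \<triangleleft>\<^bsub>N\<^esub> b \<oplus>\<^bsub>N\<^esub> \<zero>\<^bsub>N\<^esub> \<triangleleft>\<^bsub>N\<^esub> b = \<zero>\<^bsub>N\<^esub> \<triangleleft>\<^bsub>N\<^esub> b"
      using N.rsmult_add_left[of "\<zero>\<^bsub>N\<^esub>" "\<zero>\<^bsub>N\<^esub>" b] that(2) by simp
    then show ?thesis
      using N.rsmult_closed[of "\<zero>\<^bsub>N\<^esub>" b] that(2)
      by (metis N.M.add.l_cancel_one' N.M.zero_closed)
  qed
  have RS': "right_module B (F' k)" if "k \<in> I'" for k
    using RF[OF r(1)[OF that]] Fr[OF that] by simp
  have smult_closed: "rsmult ?S' x b \<in> carrier ?S'"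
    if x: "x \<in> carrier ?S'" and b: "b \<in> carrier B" for x b
  proof -
    have c: "x k \<in> carrier (F' k)" if "k \<in> I'" for k
      using x that by (auto simp: rmod_direct_sum_def)
    have "{k \<in> I'. (\<lambda>k\<in>I'. x k \<triangleleft>\<^bsub>F' k\<^esub> b) k \<noteq> \<zero>\<^bsub>F' k\<^esub>}
        \<subseteq> {k \<in> I'. x k \<noteq> \<zero>\<^bsub>F' k\<^esub>}"
      using RS' zero_smult b by auto
    moreover have "finite {k \<in> I'. x k \<noteq> \<zero>\<^bsub>F' k\<^esub>}"
      using x by (simp add: rmod_direct_sum_def)
    ultimately have "finite {k \<in> I'. (\<lambda>k\<in>I'. x k \<triangleleft>\<^bsub>F' k\<^esub> b) k \<noteq> \<zero>\<^bsub>F' k\<^esub>}"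
      by (rule finite_subset)
    then show ?thesis
      using c RS' b
      by (auto simp: rmod_direct_sum_def intro: right_module.rsmult_closed)
  qed
  have ext_add: "ext (add ?S' x y) = add ?S (ext x) (ext y)"
    if "x \<in> carrier ?S'" "y \<in> carrier ?S'" for x y
  proof
    fix i
    show "ext (add ?S' x y) i = add ?S (ext x) (ext y) i"
      using pI[of i] AG[of i]
      by (auto simp: ext_def rmod_direct_sum_def Fp abelian_groupE(2,5))
  qed
  have ext_smult: "ext (rsmult ?S' x b) = rsmult ?S (ext x) b"
    if "x \<in> carrier ?S'" "b \<in> carrier B" for x b
  proof
    fix i
    show "ext (rsmult ?S' x b) i = rsmult ?S (ext x) b i"
      using pI[of i] RF[of i] that(2)
      by (auto simp: ext_def rmod_direct_sum_def Fp zero_smult)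
  qed
  define h where "h = (\<lambda>y\<in>carrier ?S'. g (ext y))"
  have h_add: "h (add ?S' x y) = h x \<oplus>\<^bsub>M\<^esub> h y"
    if "x \<in> carrier ?S'" "y \<in> carrier ?S'" for x y
    using that by (simp add: h_def add_closed ext_add g_add ext_carrier)
  have h_closed: "h x \<in> carrier M" if "x \<in> carrier ?S'" for x
    using that by (simp add: h_def g_closed ext_carrier)
  have h_Hom: "h \<in> rmod_Hom B ?S' M"
    using h_add h_closed
    by (auto simp: rmod_Hom_def hom_def smult_closed ext_smult g_smult ext_carrier)
       (auto simp: h_def smult_closed ext_smult g_smult ext_carrier)
  have inj_in: "g (inj i a) \<in> h ` carrier ?S'" if i: "i \<in> I" and a: "a \<in> carrier (F i)" for i a
  proof -
    define y where "y = (\<lambda>k\<in>I'. if k = p i then a else \<zero>\<^bsub>F' k\<^esub>)"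
    have "{k \<in> I'. y k \<noteq> \<zero>\<^bsub>F' k\<^esub>} \<subseteq> {p i}"
      by (auto simp: y_def)
    then have "finite {k \<in> I'. y k \<noteq> \<zero>\<^bsub>F' k\<^esub>}"
      by (rule finite_subset) simp
    moreover have "\<zero>\<^bsub>F' k\<^esub> \<in> carrier (F' k)" if "k \<in> I'" for k
      using AG[OF r(1)[OF that]] Fr[OF that] by (metis abelian_groupE(2))
    ultimately have y: "y \<in> carrier ?S'"
      using a i by (auto simp: rmod_direct_sum_def y_def Fp)
    have ri: "r (p i) \<in> I" "p (r (p i)) = p i"
      using r[OF pI[OF i]] by auto
    have "ext y = inj (r (p i)) a"
    proof
      fix j
      show "ext y j = inj (r (p i)) a j"
        using ri r pI[of i] pI[of j] i by (auto simp: ext_def inj_def y_def Fp)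
    qed
    then have "h y = g (inj (r (p i)) a)"
      using y by (simp add: h_def)
    also have "\<dots> = g (inj i a)"
      using gp[OF i ri(1) ri(2)[symmetric] a] by (simp add: inj_def)
    finally show ?thesis
      using y by (metis imageI)
  qed
  have zero_in: "\<zero>\<^bsub>M\<^esub> \<in> h ` carrier ?S'"
  proof -
    define z where "z = (\<lambda>k\<in>I'. \<zero>\<^bsub>F' k\<^esub>)"
    have a: "abelian_group (F' k)" if "k \<in> I'" for k
      using AG[OF r(1)[OF that]] Fr[OF that] by simp
    have "{k \<in> I'. z k \<noteq> \<zero>\<^bsub>F' k\<^esub>} = {}"
      by (auto simp: z_def)
    then have z: "z \<in> carrier ?S'"
      using a by (auto simp: rmod_direct_sum_def z_def abelian_groupE(2))
    have "add ?S' z z = z"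
      using a by (auto simp: rmod_direct_sum_def z_def fun_eq_iff abelian_groupE(2,5))
    then have "h z \<oplus>\<^bsub>M\<^esub> h z = h z"
      using h_add[OF z z] by simp
    then have "h z = \<zero>\<^bsub>M\<^esub>"
      using h_closed[OF z] by (metis M.add.l_cancel_one')
    then show ?thesis using z by (metis imageI)
  qed
  have g_zero: "g (zero ?S) = \<zero>\<^bsub>M\<^esub>" if "zero ?S \<in> carrier ?S"
  proof -
    have "add ?S (zero ?S) (zero ?S) = zero ?S"
      using AG by (auto simp: rmod_direct_sum_def fun_eq_iff abelian_groupE(2,5))
    then have "g (zero ?S) \<oplus>\<^bsub>M\<^esub> g (zero ?S) = g (zero ?S)"
      using g_add[OF that that] by simp
    then show ?thesis
      using g_closed[OF that] by (metis M.add.l_cancel_one')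
  qed
  have surj_supp: "g x \<in> h ` carrier ?S'"
    if "finite A" "x \<in> carrier ?S" "{i \<in> I. x i \<noteq> \<zero>\<^bsub>F i\<^esub>} = A" for A x
    using that
  proof (induction A arbitrary: x)
    case empty
    then have "x = zero ?S"
      by (auto simp: rmod_direct_sum_def PiE_def extensional_def fun_eq_iff)
    then show ?case
      using empty g_zero zero_in by simp
  next
    case (insert i A)
    then have i: "i \<in> I" by blast
    have xc: "x j \<in> carrier (F j)" if "j \<in> I" for j
      using insert.prems(1) that by (auto simp: rmod_direct_sum_def)
    define w where "w = (\<lambda>j\<in>I. if j = i then \<zero>\<^bsub>F j\<^esub> else x j)"
    have wA: "{j \<in> I. w j \<noteq> \<zero>\<^bsub>F j\<^esub>} = A"
      using insert.prems(2) insert.hyps(2) by (auto simp: w_def)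
    have w: "w \<in> carrier ?S"
      using wA insert.hyps(1) xc AG
      by (auto simp: rmod_direct_sum_def abelian_groupE(2)) (auto simp: w_def abelian_groupE(2))
    have x_eq: "x = add ?S (inj i (x i)) w"
    proof
      fix j
      show "x j = add ?S (inj i (x i)) w j"
      proof (cases "j \<in> I")
        case True
        interpret Fj: abelian_group "F j" by (rule AG[OF True])
        have "x j \<oplus>\<^bsub>F j\<^esub> \<zero>\<^bsub>F j\<^esub> = x j" "\<zero>\<^bsub>F j\<^esub> \<oplus>\<^bsub>F j\<^esub> x j = x j"
          using xc[OF True] by simp_all
        then show ?thesis
          using True by (auto simp: rmod_direct_sum_def inj_def w_def)
      next
        case False
        then show ?thesis
          using insert.prems(1) by (auto simp: rmod_direct_sum_def)
      qed
    qed
    have gx: "g x = g (inj i (x i)) \<oplus>\<^bsub>M\<^esub> g w"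
      by (rule trans[OF arg_cong[OF x_eq, of g] g_add[OF inj_carrier[OF i xc[OF i]] w]])
    obtain u where u: "u \<in> carrier ?S'" "g (inj i (x i)) = h u"
      using inj_in[OF i xc[OF i]] by blast
    obtain v where v: "v \<in> carrier ?S'" "g w = h v"
      using insert.IH[OF w wA] by blast
    have "g x = h (add ?S' u v)"
      unfolding gx u(2) v(2) by (rule h_add[OF u(1) v(1), symmetric])
    then show ?case
      using add_closed u v by blast
  qed
  have "h ` carrier ?S' = carrier M"
  proof
    show "h ` carrier ?S' \<subseteq> carrier M" using h_closed by blast
    have "g x \<in> h ` carrier ?S'" if "x \<in> carrier ?S" for x
      using that surj_supp[OF _ that] by (auto simp: rmod_direct_sum_def)
    then show "carrier M \<subseteq> h ` carrier ?S'"
      unfolding g_surj[symmetric] by (rule image_subsetI)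
  qed
  moreover have "\<forall>k\<in>I'. F' k \<in> \<N>"
    using FN Fp by (auto simp: I'_def)
  ultimately have "surjection_from_direct_sum B \<N> M (p ` I) F' h"
    using h_Hom by (simp add: surjection_from_direct_sum_def I'_def)
  then show ?thesis by blast
qed

lemma generated_by_any_index:
  fixes I :: "'i set"
  assumes "\<forall>N \<in> \<N>. right_module B N" and "right_module B M"
    and "surjection_from_direct_sum B \<N> M I F g"
  shows "generated_by B \<N> M"
proof -
  let ?p = "\<lambda>i. (F i, \<lambda>a\<in>carrier (F i). g (\<lambda>k\<in>I. if k = i then a else \<zero>\<^bsub>F k\<^esub>))"
  have "\<exists>h. surjection_from_direct_sum B \<N> M (?p ` I) fst h"
  proof (rule surjection_from_direct_sum_reindex[OF assms])
    fix i j a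
    assume p: "?p i = ?p j" and a: "a \<in> carrier (F i)"
    have F: "F i = F j"
      by (rule arg_cong[OF p, of fst, unfolded fst_conv])
    have "(\<lambda>a\<in>carrier (F i). g (\<lambda>k\<in>I. if k = i then a else \<zero>\<^bsub>F k\<^esub>)) a =
        (\<lambda>a\<in>carrier (F j). g (\<lambda>k\<in>I. if k = j then a else \<zero>\<^bsub>F k\<^esub>)) a"
      by (rule fun_cong[OF arg_cong[OF p, of snd, unfolded snd_conv]])
    then show "g (\<lambda>k\<in>I. if k = i then a else \<zero>\<^bsub>F k\<^esub>) =
        g (\<lambda>k\<in>I. if k = j then a else \<zero>\<^bsub>F k\<^esub>)"
      using a a[unfolded F] by (simp only: restrict_apply')
  qed simp
  then show ?thesis
    unfolding generated_by_def by blast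
qed

end

theory Submission
  imports Defs
begin

text \<open>
  If \<open>R\<close> has local units on \<open>\<M>\<close>, let \<open>\<N>\<close> consist of the cyclic right \<open>B\<close>-modules: a
  homomorphism from a cyclic module is controlled by the image of a generator, and every module
  is the sum of its cyclic submodules.  Conversely, the elements \<open>1 - e\<close> with \<open>e \<in> R\<^sup>B\<close> are closed
  under multiplication, \<open>(1 - e) (1 - e') = 1 - (e + e' - e e')\<close>.  Applying the hypothesis to
  \<open>n \<mapsto> f n (1 - e)\<close> instead of \<open>f\<close> yields \<open>e'\<close> such that \<open>(1 - e) (1 - e')\<close> annihilates \<open>f n\<close>
  together with everything annihilated by \<open>1 - e\<close>; so finitely many elements, all of them finite
  sums of values of homomorphisms, can be annihilated one after the other.
\<close>

section \<open>Zero, negatives and finite sums under scalar multiplication\<close>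

lemma (in abelian_group) idem_zero:
  "\<lbrakk>x \<in> carrier G; x \<oplus> x = x\<rbrakk> \<Longrightarrow> x = \<zero>"
  by (metis add.l_cancel_one')

lemma (in right_module) rsmult_zero_left:
  assumes "b \<in> carrier B"
  shows "\<zero>\<^bsub>M\<^esub> \<triangleleft>\<^bsub>M\<^esub> b = \<zero>\<^bsub>M\<^esub>"
  \<comment> \<open>Additivity at \<open>0 + 0\<close> makes the value at zero idempotent, and
    \<open>idem_zero\<close> cancels. The other zero laws follow the same pattern, and the rules for
    negatives use additivity at \<open>-m + m\<close>.\<close>
  using rsmult_add_left[of "\<zero>\<^bsub>M\<^esub>" "\<zero>\<^bsub>M\<^esub>" b] assms
  by (intro M.idem_zero) (simp_all add: rsmult_closed)

lemma (in right_module) rsmult_minus_left: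
  assumes "m \<in> carrier M" "b \<in> carrier B"
  shows "(\<ominus>\<^bsub>M\<^esub> m) \<triangleleft>\<^bsub>M\<^esub> b = \<ominus>\<^bsub>M\<^esub> (m \<triangleleft>\<^bsub>M\<^esub> b)"
  using rsmult_add_left[of "\<ominus>\<^bsub>M\<^esub> m" m b] assms
  by (intro M.minus_equality[symmetric]) (simp_all add: rsmult_closed rsmult_zero_left M.l_neg)

lemma (in right_module) rsmult_zero_right:
  assumes "m \<in> carrier M"
  shows "m \<triangleleft>\<^bsub>M\<^esub> \<zero>\<^bsub>B\<^esub> = \<zero>\<^bsub>M\<^esub>"
  using rsmult_add_right[of m "\<zero>\<^bsub>B\<^esub>" "\<zero>\<^bsub>B\<^esub>"] assms
  by (intro M.idem_zero) (simp_all add: rsmult_closed)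

lemma (in right_module) rsmult_minus_right:
  assumes "m \<in> carrier M" "b \<in> carrier B"
  shows "m \<triangleleft>\<^bsub>M\<^esub> (\<ominus>\<^bsub>B\<^esub> b) = \<ominus>\<^bsub>M\<^esub> (m \<triangleleft>\<^bsub>M\<^esub> b)"
  using rsmult_add_right[of m "\<ominus>\<^bsub>B\<^esub> b" b] assms
  by (intro M.minus_equality[symmetric]) (simp_all add: rsmult_closed rsmult_zero_right B.l_neg)

lemma (in right_module) finsum_rsmult:
  assumes "finite A" "x \<in> A \<rightarrow> carrier M" "b \<in> carrier B"
  shows "finsum M x A \<triangleleft>\<^bsub>M\<^esub> b = finsum M (\<lambda>i. x i \<triangleleft>\<^bsub>M\<^esub> b) A"
  using assms
proof (induction A rule: finite_induct)
  case empty
  then show ?case by (simp add: rsmult_zero_left)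
next
  case (insert i A)
  have "(\<lambda>i. x i \<triangleleft>\<^bsub>M\<^esub> b) \<in> A \<rightarrow> carrier M"
    using insert.prems by (auto simp: Pi_iff rsmult_closed)
  moreover have "finsum M x A \<in> carrier M"
    using insert.prems by (intro M.finsum_closed) auto
  ultimately show ?case
    using insert by (simp add: Pi_iff rsmult_closed rsmult_add_left)
qed

lemma (in bimodule) lsmult_zero_right:
  assumes "b \<in> carrier B"
  shows "b \<triangleright>\<^bsub>R\<^esub> \<zero>\<^bsub>R\<^esub> = \<zero>\<^bsub>R\<^esub>"
  using lsmult_add_right[of b "\<zero>\<^bsub>R\<^esub>" "\<zero>\<^bsub>R\<^esub>"] assms
  by (intro M.idem_zero) (simp_all add: lsmult_closed)

lemma (in bimodule) lsmult_minus_right: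
  assumes "b \<in> carrier B" "r \<in> carrier R"
  shows "b \<triangleright>\<^bsub>R\<^esub> (\<ominus>\<^bsub>R\<^esub> r) = \<ominus>\<^bsub>R\<^esub> (b \<triangleright>\<^bsub>R\<^esub> r)"
  using lsmult_add_right[of b "\<ominus>\<^bsub>R\<^esub> r" r] assms
  by (intro M.minus_equality[symmetric]) (simp_all add: lsmult_closed lsmult_zero_right M.l_neg)

text \<open>The circle operation of ring theory, for which \<open>1 - e \<circ> e' = (1 - e) (1 - e')\<close>.\<close>

definition circle :: "('r, 'z) ring_scheme \<Rightarrow> 'r \<Rightarrow> 'r \<Rightarrow> 'r" where
  "circle R e e' = (e \<oplus>\<^bsub>R\<^esub> e') \<oplus>\<^bsub>R\<^esub> \<ominus>\<^bsub>R\<^esub> (e \<otimes>\<^bsub>R\<^esub> e')"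

section \<open>Centralizing elements and the circle operation\<close>

lemma (in nonunital_B_ring) centralizing_zero: "\<zero>\<^bsub>R\<^esub> \<in> centralizing_elements B R"
  by (simp add: centralizing_elements_def lsmult_zero_right rsmult_zero_left)

lemma (in nonunital_B_ring) centralizing_circle:
  assumes "e \<in> centralizing_elements B R" "e' \<in> centralizing_elements B R"
  shows "circle R e e' \<in> centralizing_elements B R"
proof -
  have c: "e \<in> carrier R" "e' \<in> carrier R"
    using assms by (auto simp: centralizing_elements_def)
  have bal: "b \<triangleright>\<^bsub>R\<^esub> e = e \<triangleleft>\<^bsub>R\<^esub> b" "b \<triangleright>\<^bsub>R\<^esub> e' = e' \<triangleleft>\<^bsub>R\<^esub> b" if "b \<in> carrier B" for b
    using assms that by (auto simp: centralizing_elements_def)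
  \<comment> \<open>The scalar moves through the product as b(ee') = (be)e' = (eb)e' = e(be') =
    e(e'b) = (ee')b.\<close>
  have "b \<triangleright>\<^bsub>R\<^esub> (e \<otimes>\<^bsub>R\<^esub> e') = (e \<otimes>\<^bsub>R\<^esub> e') \<triangleleft>\<^bsub>R\<^esub> b" if b: "b \<in> carrier B" for b
    using c b by (metis bal mult_balanced mult_left_linear mult_right_linear)
  then show ?thesis
    using c by (simp add: centralizing_elements_def circle_def mult_closed lsmult_add_right
        rsmult_add_left lsmult_minus_right rsmult_minus_left bal)
qed

section \<open>Zero and negatives under the action of \<open>R\<close>\<close>

lemma (in right_R_module) ract_zero_left:
  assumes "r \<in> carrier R"
  shows "\<zero>\<^bsub>M\<^esub> \<bullet>\<^bsub>M\<^esub> r = \<zero>\<^bsub>M\<^esub>"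
  using ract_add_left[of "\<zero>\<^bsub>M\<^esub>" "\<zero>\<^bsub>M\<^esub>" r] assms
  by (intro M.idem_zero) (simp_all add: ract_closed)

lemma (in right_R_module) ract_zero_right:
  assumes "m \<in> carrier M"
  shows "m \<bullet>\<^bsub>M\<^esub> \<zero>\<^bsub>R\<^esub> = \<zero>\<^bsub>M\<^esub>"
  using ract_add_right[of m "\<zero>\<^bsub>R\<^esub>" "\<zero>\<^bsub>R\<^esub>"] assms
  by (intro M.idem_zero) (simp_all add: ract_closed)

lemma (in right_R_module) ract_minus_left:
  assumes "m \<in> carrier M" "r \<in> carrier R"
  shows "(\<ominus>\<^bsub>M\<^esub> m) \<bullet>\<^bsub>M\<^esub> r = \<ominus>\<^bsub>M\<^esub> (m \<bullet>\<^bsub>M\<^esub> r)"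
  using ract_add_left[of "\<ominus>\<^bsub>M\<^esub> m" m r] assms
  by (intro M.minus_equality[symmetric]) (simp_all add: ract_closed ract_zero_left M.l_neg)

lemma (in right_R_module) ract_minus_right:
  assumes "m \<in> carrier M" "r \<in> carrier R"
  shows "m \<bullet>\<^bsub>M\<^esub> (\<ominus>\<^bsub>R\<^esub> r) = \<ominus>\<^bsub>M\<^esub> (m \<bullet>\<^bsub>M\<^esub> r)"
  using ract_add_right[of m "\<ominus>\<^bsub>R\<^esub> r" r] assms
  by (intro M.minus_equality[symmetric]) (simp_all add: ract_closed ract_zero_right R.M.l_neg)

text \<open>The action of \<open>1 - e\<close>, which is not an element of \<open>R\<close>.\<close>

definition ract_defect :: "('b, 'r, 'm, 'z) Rmod_scheme \<Rightarrow> 'm \<Rightarrow> 'r \<Rightarrow> 'm" where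
  "ract_defect M m e = m \<oplus>\<^bsub>M\<^esub> \<ominus>\<^bsub>M\<^esub> (m \<bullet>\<^bsub>M\<^esub> e)"

section \<open>The operators \<open>1 - e\<close> on a module\<close>

lemma (in right_R_module) ract_defect_closed:
  "\<lbrakk>m \<in> carrier M; e \<in> carrier R\<rbrakk> \<Longrightarrow> ract_defect M m e \<in> carrier M"
  by (simp add: ract_defect_def ract_closed)

lemma (in right_R_module) ract_defect_eq_zero_iff:
  assumes "m \<in> carrier M" "e \<in> carrier R"
  shows "ract_defect M m e = \<zero>\<^bsub>M\<^esub> \<longleftrightarrow> m \<bullet>\<^bsub>M\<^esub> e = m"
  using assms unfolding ract_defect_def
  by (metis M.add.inv_closed M.minus_equality M.minus_minus M.r_neg ract_closed)

lemma (in right_R_module) ract_defect_add: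
  "\<lbrakk>m \<in> carrier M; n \<in> carrier M; e \<in> carrier R\<rbrakk>
    \<Longrightarrow> ract_defect M (m \<oplus>\<^bsub>M\<^esub> n) e = ract_defect M m e \<oplus>\<^bsub>M\<^esub> ract_defect M n e"
  by (simp add: ract_defect_def ract_closed ract_add_left M.minus_add M.a_ac)

lemma (in right_R_module) ract_defect_zero:
  "e \<in> carrier R \<Longrightarrow> ract_defect M \<zero>\<^bsub>M\<^esub> e = \<zero>\<^bsub>M\<^esub>"
  by (simp add: ract_defect_eq_zero_iff ract_zero_left)

text \<open>(mb)e = m(be) = m(eb) = (me)b. This is where membership of \<open>e\<close> in
  \<open>R^B\<close> enters: it makes \<open>f_e\<close>, and with it \<open>1 - e\<close>, right
  \<open>B\<close>-linear.\<close>

lemma (in right_R_module) ract_rsmult_centralizing: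
  assumes "m \<in> carrier M" "b \<in> carrier B" "e \<in> centralizing_elements B R"
  shows "(m \<triangleleft>\<^bsub>M\<^esub> b) \<bullet>\<^bsub>M\<^esub> e = (m \<bullet>\<^bsub>M\<^esub> e) \<triangleleft>\<^bsub>M\<^esub> b"
  using assms by (simp add: centralizing_elements_def ract_balanced ract_right_linear)

lemma (in right_R_module) ract_defect_rsmult:
  assumes "m \<in> carrier M" "b \<in> carrier B" "e \<in> centralizing_elements B R"
  shows "ract_defect M (m \<triangleleft>\<^bsub>M\<^esub> b) e = ract_defect M m e \<triangleleft>\<^bsub>M\<^esub> b"
proof -
  have "e \<in> carrier R" using assms(3) by (simp add: centralizing_elements_def)
  then show ?thesis
    using assms by (simp add: ract_defect_def ract_rsmult_centralizing ract_closed
        M.rsmult_add_left M.rsmult_minus_left)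
qed

text \<open>Both sides expand to m - me - me' + (me)e', where associativity turns m(ee') into
  (me)e'.\<close>

lemma (in right_R_module) ract_defect_circle:
  assumes "m \<in> carrier M" "e \<in> carrier R" "e' \<in> carrier R"
  shows "ract_defect M m (circle R e e') = ract_defect M (ract_defect M m e) e'"
  using assms
  by (simp add: ract_defect_def circle_def ract_closed ract_add_left ract_add_right
      ract_minus_left ract_minus_right R.mult_closed ract_assoc M.minus_add M.a_ac)

text \<open>\<open>1 - e\<close> is \<open>B\<close>-linear although it is not given by an element
  of \<open>R\<close>, so composing with it yields further homomorphisms to which the hypothesis of
  the theorem applies.\<close>

lemma (in right_R_module) rmod_Hom_ract_defect:
  assumes N: "right_module B N" and f: "f \<in> rmod_Hom B N M"
    and e: "e \<in> centralizing_elements B R"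
  shows "(\<lambda>n\<in>carrier N. ract_defect M (f n) e) \<in> rmod_Hom B N M"
proof -
  interpret N: right_module B N by (rule N)
  have "e \<in> carrier R" using e by (simp add: centralizing_elements_def)
  then show ?thesis
    using f e
    by (auto simp: rmod_Hom_def hom_def Pi_iff ract_defect_closed ract_defect_add
        ract_defect_rsmult N.rsmult_closed)
qed

text \<open>By minimality of the hull, an \<open>e\<close> that fixes generators then fixes the
  whole submodule they generate.\<close>

lemma (in right_R_module) right_submodule_ract_fixed:
  assumes "e \<in> centralizing_elements B R"
  shows "right_submodule B M {m \<in> carrier M. m \<bullet>\<^bsub>M\<^esub> e = m}"
proof -
  have "e \<in> carrier R" using assms by (simp add: centralizing_elements_def)
  then show ?thesis
    using assms unfolding right_submodule_def
    by (auto intro!: additive_subgroup.intro M.add.subgroupI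
        simp: ract_add_left ract_minus_left ract_zero_left ract_rsmult_centralizing M.rsmult_closed
        simp flip: a_inv_def)
qed

text \<open>
  Here \<open>e\<close> stands for a unit already found for other elements; the condition says that it can be
  enlarged to one that also fixes \<open>m\<close>.
\<close>

definition absorbable ::
    "('b, 'x) ring_scheme \<Rightarrow> ('b, 'r, 'y) bring_scheme \<Rightarrow> ('b, 'r, 'm, 'z) Rmod_scheme \<Rightarrow> 'm set" where
  "absorbable B R M = {m \<in> carrier M. \<forall>e \<in> centralizing_elements B R.
     \<exists>e' \<in> centralizing_elements B R. ract_defect M (ract_defect M m e) e' = \<zero>\<^bsub>M\<^esub>}"

section \<open>Absorbable elements and common local units\<close>

lemma (in right_R_module) absorbable_zero: "\<zero>\<^bsub>M\<^esub> \<in> absorbable B R M"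
  using R.centralizing_zero
  by (auto simp: absorbable_def centralizing_elements_def ract_defect_zero)

text \<open>The two summands are annihilated one after the other. This is why absorbability
  quantifies over every \<open>e\<close>: the element for \<open>n\<close> has to be chosen relative
  to the unit already enlarged for \<open>m\<close>.\<close>

lemma (in right_R_module) absorbable_add:
  assumes m: "m \<in> absorbable B R M" and n: "n \<in> absorbable B R M"
  shows "m \<oplus>\<^bsub>M\<^esub> n \<in> absorbable B R M"
proof -
  let ?C = "centralizing_elements B R"
  have c: "m \<in> carrier M" "n \<in> carrier M"
    using m n by (auto simp: absorbable_def)
  have C: "x \<in> carrier R" if "x \<in> ?C" for x
    using that by (simp add: centralizing_elements_def)
  have "\<exists>e'\<in>?C. ract_defect M (ract_defect M (m \<oplus>\<^bsub>M\<^esub> n) e) e' = \<zero>\<^bsub>M\<^esub>" if e: "e \<in> ?C" for e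
  proof -
    obtain p where p: "p \<in> ?C" "ract_defect M (ract_defect M m e) p = \<zero>\<^bsub>M\<^esub>"
      using m e by (auto simp: absorbable_def)
    have "circle R e p \<in> ?C" using e p R.centralizing_circle by blast
    then obtain q where q: "q \<in> ?C"
        "ract_defect M (ract_defect M n (circle R e p)) q = \<zero>\<^bsub>M\<^esub>"
      using n by (auto simp: absorbable_def)
    \<comment> \<open>The factors \<open>1 - e\<close>, \<open>1 - p\<close>, \<open>1 - q\<close>
      act in turn: the contribution of \<open>m\<close> vanishes after the second, that of
      \<open>n\<close> after the third.\<close>
    have "ract_defect M (ract_defect M (m \<oplus>\<^bsub>M\<^esub> n) e) (circle R p q) = \<zero>\<^bsub>M\<^esub>"
      using c e p q C
      by (simp add: ract_defect_add ract_defect_circle ract_defect_closed ract_defect_zero)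
    then show ?thesis using p q R.centralizing_circle by blast
  qed
  then show ?thesis using c by (simp add: absorbable_def)
qed

lemma (in right_R_module) finite_absorbable_unit:
  assumes "finite S" "S \<subseteq> absorbable B R M"
  shows "\<exists>e \<in> centralizing_elements B R. \<forall>s \<in> S. s \<bullet>\<^bsub>M\<^esub> e = s"
  using assms
proof (induction S rule: finite_induct)
  case empty
  then show ?case using R.centralizing_zero by auto
next
  case (insert s S)
  let ?C = "centralizing_elements B R"
  have C: "x \<in> carrier R" if "x \<in> ?C" for x
    using that by (simp add: centralizing_elements_def)
  have c: "x \<in> carrier M" if "x \<in> insert s S" for x
    using insert.prems that by (auto simp: absorbable_def)
  obtain e where e: "e \<in> ?C" "\<forall>s\<in>S. s \<bullet>\<^bsub>M\<^esub> e = s"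
    using insert by auto
  obtain e' where e': "e' \<in> ?C" "ract_defect M (ract_defect M s e) e' = \<zero>\<^bsub>M\<^esub>"
    using insert.prems e by (auto simp: absorbable_def)
  have E: "circle R e e' \<in> ?C" using e e' R.centralizing_circle by blast
  have "ract_defect M t (circle R e e') = \<zero>\<^bsub>M\<^esub>" if t: "t \<in> insert s S" for t
  proof (cases "t = s")
    case False
    \<comment> \<open>An element of \<open>S\<close> is already annihilated by \<open>1 - e\<close>,
      and the further factor \<open>1 - e'\<close> sends zero to zero.\<close>
    then have "ract_defect M t e = \<zero>\<^bsub>M\<^esub>"
      using t e c C by (auto simp: ract_defect_eq_zero_iff)
    then show ?thesis
      using c[OF t] C e e' by (simp add: ract_defect_circle ract_defect_zero)
  qed (use c[OF t] C e e' in \<open>simp add: ract_defect_circle\<close>)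
  then show ?case
    using E c C by (metis ract_defect_eq_zero_iff)
qed

lemma (in right_R_module) rmod_Hom_image_absorbable:
  assumes N: "right_module B N"
    and unit: "\<forall>f \<in> rmod_Hom B N M.
      \<exists>e \<in> centralizing_elements B R. f = compose (carrier N) (right_mult_map M e) f"
    and f: "f \<in> rmod_Hom B N M" and n: "n \<in> carrier N"
  shows "f n \<in> absorbable B R M"
proof -
  let ?C = "centralizing_elements B R"
  have fn: "f n \<in> carrier M"
    using f n by (auto simp: rmod_Hom_def hom_def)
  have C: "x \<in> carrier R" if "x \<in> ?C" for x
    using that by (simp add: centralizing_elements_def)
  have "\<exists>e'\<in>?C. ract_defect M (ract_defect M (f n) e) e' = \<zero>\<^bsub>M\<^esub>" if e: "e \<in> ?C" for e
  proof -
    \<comment> \<open>Applying \<open>unit\<close> to \<open>f\<close> itself would settle only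
      \<open>e = 0\<close>; the twisted map \<open>?h\<close> covers an arbitrary
      \<open>e\<close>.\<close>
    let ?h = "\<lambda>n\<in>carrier N. ract_defect M (f n) e"
    obtain e' where e': "e' \<in> ?C" "?h = compose (carrier N) (right_mult_map M e') ?h"
      using bspec[OF unit rmod_Hom_ract_defect[OF N f e]] by (rule bexE)
    have "ract_defect M (f n) e = ract_defect M (f n) e \<bullet>\<^bsub>M\<^esub> e'"
      using fun_cong[OF e'(2), of n] n fn C[OF e]
      by (simp add: compose_def right_mult_map_def ract_defect_closed)
    then have "ract_defect M (ract_defect M (f n) e) e' = \<zero>\<^bsub>M\<^esub>"
      using fn C e e' by (simp add: ract_defect_eq_zero_iff ract_defect_closed)
    then show ?thesis using e' by blast
  qed
  then show ?thesis using fn by (simp add: absorbable_def)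
qed

section \<open>Direct sums: inclusions of summands and induction\<close>

definition direct_sum_inj ::
    "'i set \<Rightarrow> ('i \<Rightarrow> ('b, 'n) rmod) \<Rightarrow> 'i \<Rightarrow> 'n \<Rightarrow> 'i \<Rightarrow> 'n" where
  "direct_sum_inj I F i a = (\<lambda>j\<in>I. if j = i then a else \<zero>\<^bsub>F j\<^esub>)"

lemma direct_sum_inj_closed:
  assumes F: "\<And>j. j \<in> I \<Longrightarrow> right_module B (F j)" and "i \<in> I" "a \<in> carrier (F i)"
  shows "direct_sum_inj I F i a \<in> carrier (rmod_direct_sum I F)"
proof -
  have "finite {j \<in> I. direct_sum_inj I F i a j \<noteq> \<zero>\<^bsub>F j\<^esub>}"
    by (rule finite_subset[of _ "{i}"]) (auto simp: direct_sum_inj_def)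
  moreover have "\<zero>\<^bsub>F j\<^esub> \<in> carrier (F j)" if "j \<in> I" for j
    using F[OF that] by (simp add: right_module_def abelian_groupE(2))
  ultimately show ?thesis
    using assms by (auto simp: rmod_direct_sum_def direct_sum_inj_def)
qed

text \<open>Restricting \<open>g\<close> to a summand gives a homomorphism out of a single
  \<open>F i\<close>. Away from the coordinate \<open>i\<close>, linearity of the inclusion comes
  down to 0 + 0 = 0 and 0 b = 0 in the other summands.\<close>

lemma direct_sum_inj_Hom:
  assumes F: "\<And>j. j \<in> I \<Longrightarrow> right_module B (F j)" and i: "i \<in> I"
    and g: "g \<in> rmod_Hom B (rmod_direct_sum I F) M"
  shows "(\<lambda>a\<in>carrier (F i). g (direct_sum_inj I F i a)) \<in> rmod_Hom B (F i) M"
proof -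
  let ?S = "rmod_direct_sum I F"
  interpret Fi: right_module B "F i" by (rule F[OF i])
  note cl = direct_sum_inj_closed[where F = F, OF F i]
  have "direct_sum_inj I F i (a \<oplus>\<^bsub>F i\<^esub> c) =
      direct_sum_inj I F i a \<oplus>\<^bsub>?S\<^esub> direct_sum_inj I F i c" for a c
    using F by (auto simp: direct_sum_inj_def rmod_direct_sum_def fun_eq_iff right_module_def
        abelian_groupE(2,5))
  moreover have "direct_sum_inj I F i (a \<triangleleft>\<^bsub>F i\<^esub> b) = direct_sum_inj I F i a \<triangleleft>\<^bsub>?S\<^esub> b"
    if "b \<in> carrier B" for a b
    using right_module.rsmult_zero_left[OF F that]
    by (auto simp: direct_sum_inj_def rmod_direct_sum_def fun_eq_iff)
  ultimately show ?thesis
    using g cl by (auto simp: rmod_Hom_def hom_def Pi_iff Fi.rsmult_closed)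
qed

text \<open>Supports are finite, so erasing one nonzero coordinate at a time ends at zero. Claims
  about a direct sum are thereby reduced to its single summands.\<close>

lemma direct_sum_induct:
  assumes x: "x \<in> carrier (rmod_direct_sum I F)"
    and F: "\<And>i. i \<in> I \<Longrightarrow> right_module B (F i)"
    and zero: "P \<zero>\<^bsub>rmod_direct_sum I F\<^esub>"
    and add: "\<And>i a w. \<lbrakk>i \<in> I; a \<in> carrier (F i); w \<in> carrier (rmod_direct_sum I F); P w\<rbrakk>
      \<Longrightarrow> P (direct_sum_inj I F i a \<oplus>\<^bsub>rmod_direct_sum I F\<^esub> w)"
  shows "P x"
proof -
  let ?S = "rmod_direct_sum I F"
  have AG: "abelian_group (F i)" if "i \<in> I" for i
    using F[OF that] by (simp add: right_module_def)
  have step: "P x" if "finite A" "x \<in> carrier ?S" "{i \<in> I. x i \<noteq> \<zero>\<^bsub>F i\<^esub>} = A" for A x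
    using that
  proof (induction A arbitrary: x)
    case empty
    then have "x = \<zero>\<^bsub>?S\<^esub>"
      by (auto simp: rmod_direct_sum_def PiE_def extensional_def fun_eq_iff)
    then show ?case using zero by simp
  next
    case (insert i A)
    then have i: "i \<in> I" by blast
    have xc: "x j \<in> carrier (F j)" if "j \<in> I" for j
      using insert.prems(1) that by (auto simp: rmod_direct_sum_def)
    \<comment> \<open>\<open>w\<close> is \<open>x\<close> with the coordinate \<open>i\<close>
      erased; its support is exactly \<open>A\<close>, so the induction hypothesis applies to
      it.\<close>
    define w where "w = (\<lambda>j\<in>I. if j = i then \<zero>\<^bsub>F j\<^esub> else x j)"
    have wA: "{j \<in> I. w j \<noteq> \<zero>\<^bsub>F j\<^esub>} = A"
      using insert.prems(2) insert.hyps(2) by (auto simp: w_def)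
    have w: "w \<in> carrier ?S"
      using wA insert.hyps(1) xc AG
      by (auto simp: rmod_direct_sum_def abelian_groupE(2)) (auto simp: w_def abelian_groupE(2))
    have "x = direct_sum_inj I F i (x i) \<oplus>\<^bsub>?S\<^esub> w"
    proof
      fix j
      show "x j = (direct_sum_inj I F i (x i) \<oplus>\<^bsub>?S\<^esub> w) j"
      proof (cases "j \<in> I")
        case True
        interpret Fj: abelian_group "F j" by (rule AG[OF True])
        have "x j \<oplus>\<^bsub>F j\<^esub> \<zero>\<^bsub>F j\<^esub> = x j" "\<zero>\<^bsub>F j\<^esub> \<oplus>\<^bsub>F j\<^esub> x j = x j"
          using xc[OF True] by simp_all
        then show ?thesis
          using True by (auto simp: rmod_direct_sum_def direct_sum_inj_def w_def)
      next
        case False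
        then show ?thesis
          using insert.prems(1) by (auto simp: rmod_direct_sum_def)
      qed
    qed
    then show ?case
      \<comment> \<open>The right-hand side still mentions \<open>x\<close>, through
        \<open>x i\<close>, so the equation is substituted once; as a rewrite rule it would
        loop.\<close>
      by (rule ssubst[where P = P]) (rule add[OF i xc[OF i] w insert.IH[OF w wA]])
  qed
  have "finite {i \<in> I. x i \<noteq> \<zero>\<^bsub>F i\<^esub>}"
    using x by (simp add: rmod_direct_sum_def)
  from this x refl show ?thesis by (rule step)
qed

section \<open>From generation to local units\<close>

lemma (in right_R_module) local_units_if_generated:
  fixes \<N> :: "('b, 'n) rmod set"
  assumes \<N>: "\<And>N. N \<in> \<N> \<Longrightarrow> right_module B N" and gen: "generated_by B \<N> M"
    and unit: "\<And>N. N \<in> \<N> \<Longrightarrow> \<forall>f \<in> rmod_Hom B N M.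
      \<exists>e \<in> centralizing_elements B R. f = compose (carrier N) (right_mult_map M e) f"
  shows "has_right_local_units B R M"
proof -
  obtain I :: "(('b, 'n) rmod \<times> ('n \<Rightarrow> 'm)) set" and F g where g: "surjection_from_direct_sum B \<N> M I F g"
    using gen unfolding generated_by_def by (elim exE)
  let ?S = "rmod_direct_sum I F"
  have F\<N>: "F i \<in> \<N>" if "i \<in> I" for i
    using g that by (simp add: surjection_from_direct_sum_def)
  have F: "right_module B (F i)" if "i \<in> I" for i
    using F\<N> \<N> that by blast
  have g_Hom: "g \<in> rmod_Hom B ?S M" and g_surj: "g ` carrier ?S = carrier M"
    using g by (auto simp: surjection_from_direct_sum_def)
  have g_closed: "g x \<in> carrier M" if "x \<in> carrier ?S" for x
    using g_Hom that by (auto simp: rmod_Hom_def hom_def)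
  have g_add: "g (x \<oplus>\<^bsub>?S\<^esub> y) = g x \<oplus>\<^bsub>M\<^esub> g y" if "x \<in> carrier ?S" "y \<in> carrier ?S" for x y
    using g_Hom that by (auto simp: rmod_Hom_def hom_def)
  have AG: "abelian_group (F i)" if "i \<in> I" for i
    using F[OF that] by (simp add: right_module_def)
  have zc: "\<zero>\<^bsub>?S\<^esub> \<in> carrier ?S"
  proof -
    have "{i \<in> I. (\<lambda>i\<in>I. \<zero>\<^bsub>F i\<^esub>) i \<noteq> \<zero>\<^bsub>F i\<^esub>} = {}" by auto
    then show ?thesis using AG by (auto simp: rmod_direct_sum_def abelian_groupE(2))
  qed
  \<comment> \<open>\<open>rmod_Hom\<close> does not list preservation of zero, so it is derived
    from additivity of \<open>g\<close> at 0 + 0 = 0.\<close>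
  have "\<zero>\<^bsub>?S\<^esub> \<oplus>\<^bsub>?S\<^esub> \<zero>\<^bsub>?S\<^esub> = \<zero>\<^bsub>?S\<^esub>"
    using AG by (auto simp: rmod_direct_sum_def fun_eq_iff abelian_groupE(2,5))
  then have g_zero: "g \<zero>\<^bsub>?S\<^esub> = \<zero>\<^bsub>M\<^esub>"
    using g_add[OF zc zc] g_closed[OF zc] by (intro M.idem_zero) simp_all
  \<comment> \<open>Each \<open>g x\<close> is built from zero by adding values of homomorphisms out
    of single objects of \<N>. Such values are absorbable, and sums of absorbable elements stay
    absorbable.\<close>
  have "g x \<in> absorbable B R M" if "x \<in> carrier ?S" for x
    using that F
  proof (rule direct_sum_induct)
    show "g \<zero>\<^bsub>?S\<^esub> \<in> absorbable B R M"
      by (simp add: g_zero absorbable_zero)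
    fix i a w
    assume i: "i \<in> I" and a: "a \<in> carrier (F i)" and w: "w \<in> carrier ?S" "g w \<in> absorbable B R M"
    have "(\<lambda>a\<in>carrier (F i). g (direct_sum_inj I F i a)) \<in> rmod_Hom B (F i) M"
      by (rule direct_sum_inj_Hom[OF _ i g_Hom]) (rule F)
    then have "(\<lambda>a\<in>carrier (F i). g (direct_sum_inj I F i a)) a \<in> absorbable B R M"
      by (rule rmod_Hom_image_absorbable[OF F[OF i] unit[OF F\<N>[OF i]] _ a])
    then have "g (direct_sum_inj I F i a) \<oplus>\<^bsub>M\<^esub> g w \<in> absorbable B R M"
      using a w(2) by (simp add: absorbable_add)
    moreover have "direct_sum_inj I F i a \<in> carrier ?S"
      by (rule direct_sum_inj_closed[where F = F, OF _ i a]) (rule F)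
    ultimately show "g (direct_sum_inj I F i a \<oplus>\<^bsub>?S\<^esub> w) \<in> absorbable B R M"
      by (simp only: g_add w(1))
  qed
  then have all: "carrier M \<subseteq> absorbable B R M"
    unfolding g_surj[symmetric] by (rule image_subsetI)
  show ?thesis
    unfolding has_right_local_units_def
  proof (intro allI impI)
    fix N assume "fg_right_submodule B M N"
    then obtain S where S: "finite S" "S \<subseteq> carrier M" "N = right_submodule B M hull S"
      by (auto simp: fg_right_submodule_def)
    obtain e where e: "e \<in> centralizing_elements B R" "\<forall>s\<in>S. s \<bullet>\<^bsub>M\<^esub> e = s"
      using finite_absorbable_unit[OF S(1) subset_trans[OF S(2) all]] by (rule bexE)
    have "N \<subseteq> {m \<in> carrier M. m \<bullet>\<^bsub>M\<^esub> e = m}"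
      unfolding S(3) using S(2) e by (intro hull_minimal right_submodule_ract_fixed) auto
    then show "\<exists>e\<in>centralizing_elements B R. \<forall>n\<in>N. n \<bullet>\<^bsub>M\<^esub> e = n"
      using e by blast
  qed
qed

section \<open>Cyclic modules: from local units to generation\<close>

definition cyclic_right_module :: "('b, 'x) ring_scheme \<Rightarrow> ('b, 'n) rmod \<Rightarrow> bool" where
  "cyclic_right_module B N \<longleftrightarrow>
     right_module B N \<and> (\<exists>n \<in> carrier N. carrier N = (\<lambda>b. n \<triangleleft>\<^bsub>N\<^esub> b) ` carrier B)"

text \<open>The operations are those of \<open>M\<close> itself, so the laws of \<open>M\<close>
  carry over and only closure needs an argument. The record lives on the carrier type of
  \<open>M\<close>, as the objects of \<N> in the theorem do.\<close>

definition cyclic_submodule ::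
    "('b, 'x) ring_scheme \<Rightarrow> ('b, 'm, 'y) rmod_scheme \<Rightarrow> 'm \<Rightarrow> ('b, 'm) rmod" where
  "cyclic_submodule B M m = \<lparr>carrier = (\<lambda>b. m \<triangleleft>\<^bsub>M\<^esub> b) ` carrier B, mult = undefined,
     one = undefined, zero = \<zero>\<^bsub>M\<^esub>, add = add M, rsmult = rsmult M\<rparr>"

lemma (in right_module) cyclic_submodule_mem:
  assumes "m \<in> carrier M"
  shows "m \<in> carrier (cyclic_submodule B M m)"
  using rsmult_one[OF assms] by (auto simp: cyclic_submodule_def intro!: image_eqI[of _ _ "\<one>\<^bsub>B\<^esub>"])

lemma (in right_module) cyclic_submodule_subset:
  "m \<in> carrier M \<Longrightarrow> carrier (cyclic_submodule B M m) \<subseteq> carrier M"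
  by (auto simp: cyclic_submodule_def rsmult_closed)

text \<open>Closure holds because 0 = m0, mb + mc = m(b + c), -(mb) = m(-b) and (mb)c = m(bc); the
  flipped rules recombine the scalars accordingly.\<close>

lemma (in right_module) cyclic_submodule_right_module:
  assumes m: "m \<in> carrier M"
  shows "right_module B (cyclic_submodule B M m)"
proof -
  let ?N = "cyclic_submodule B M m"
  note sub = subsetD[OF cyclic_submodule_subset[OF m]]
  have zero: "\<zero>\<^bsub>M\<^esub> \<in> carrier ?N"
    using rsmult_zero_right[OF m]
    by (auto simp: cyclic_submodule_def intro!: image_eqI[of _ _ "\<zero>\<^bsub>B\<^esub>"])
  have add: "x \<oplus>\<^bsub>M\<^esub> y \<in> carrier ?N" if "x \<in> carrier ?N" "y \<in> carrier ?N" for x y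
    using that m by (auto simp: cyclic_submodule_def simp flip: rsmult_add_right)
  have neg: "\<ominus>\<^bsub>M\<^esub> x \<in> carrier ?N" if "x \<in> carrier ?N" for x
    using that m by (auto simp: cyclic_submodule_def simp flip: rsmult_minus_right)
  have smult: "x \<triangleleft>\<^bsub>M\<^esub> b \<in> carrier ?N" if "x \<in> carrier ?N" "b \<in> carrier B" for x b
    using that m by (auto simp: cyclic_submodule_def simp flip: rsmult_assoc)
  have [simp]: "\<zero>\<^bsub>?N\<^esub> = \<zero>\<^bsub>M\<^esub>" "add ?N = add M" "rsmult ?N = rsmult M"
    by (simp_all add: cyclic_submodule_def)
  have "abelian_group ?N"
  proof (rule abelian_groupI)
    show "\<exists>y\<in>carrier ?N. y \<oplus>\<^bsub>?N\<^esub> x = \<zero>\<^bsub>?N\<^esub>" if "x \<in> carrier ?N" for x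
      using neg[OF that] sub[OF that] by (auto simp: M.l_neg intro!: bexI[of _ "\<ominus>\<^bsub>M\<^esub> x"])
  qed (simp_all add: zero add sub M.a_ac)
  then show ?thesis
    by (intro right_module.intro right_module_axioms.intro B.ring_axioms)
      (simp_all add: smult sub rsmult_add_left rsmult_add_right rsmult_assoc rsmult_one)
qed

lemma (in right_module) cyclic_submodule_cyclic:
  assumes "m \<in> carrier M"
  shows "cyclic_right_module B (cyclic_submodule B M m)"
  unfolding cyclic_right_module_def
  using cyclic_submodule_right_module[OF assms]
  by (intro conjI bexI[OF _ cyclic_submodule_mem[OF assms]]) (simp_all add: cyclic_submodule_def)

text \<open>Take one summand \<open>mB\<close> for each \<open>m\<close> in \<open>carrier M\<close>
  and let \<open>g\<close> add up the coordinates. Surjectivity follows since \<open>m\<close> lies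
  in its own summand.\<close>

lemma (in right_module) generated_by_cyclic:
  "generated_by B {N :: ('b, 'm) rmod. cyclic_right_module B N} M"
proof -
  let ?I = "carrier M"
  let ?F = "cyclic_submodule B M"
  let ?S = "rmod_direct_sum ?I ?F"
  have [simp]: "\<zero>\<^bsub>?F i\<^esub> = \<zero>\<^bsub>M\<^esub>" "add (?F i) = add M" "rsmult (?F i) = rsmult M" for i
    by (simp_all add: cyclic_submodule_def)
  have F: "right_module B (?F i)" if "i \<in> ?I" for i
    using that by (rule cyclic_submodule_right_module)
  define supp where "supp x = {i \<in> ?I. x i \<noteq> \<zero>\<^bsub>M\<^esub>}" for x
  \<comment> \<open>Summing over the support keeps the index set finite; over an infinite
    \<open>carrier M\<close>, \<open>finsum\<close> would return its default value zero.\<close>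
  define g where "g = (\<lambda>x\<in>carrier ?S. finsum M x (supp x))"
  have supp_fin: "finite (supp x)" if "x \<in> carrier ?S" for x
    using that by (simp add: rmod_direct_sum_def supp_def)
  have val: "x i \<in> carrier (?F i)" if "x \<in> carrier ?S" "i \<in> ?I" for x i
    using that by (auto simp: rmod_direct_sum_def)
  have xc: "x i \<in> carrier M" if "x \<in> carrier ?S" "i \<in> ?I" for x i
    using val[OF that] cyclic_submodule_subset[OF that(2)] by blast
  \<comment> \<open>Extra indices contribute only zeros, so the sums for two elements can be taken
    over one common finite set, as additivity requires.\<close>
  have g_eq: "g x = finsum M x A"
    if x: "x \<in> carrier ?S" and A: "finite A" "supp x \<subseteq> A" "A \<subseteq> ?I" for x A
  proof -
    have "finsum M x (supp x) = finsum M x A"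
      using A xc[OF x] by (intro M.add.finprod_mono_neutral_cong_left) (auto simp: supp_def)
    then show ?thesis using x by (simp add: g_def)
  qed
  have g_closed: "g x \<in> carrier M" if "x \<in> carrier ?S" for x
    using xc[OF that] that by (auto simp: g_def supp_def intro!: M.finsum_closed)
  have S_simps: "(x \<oplus>\<^bsub>?S\<^esub> y) i = x i \<oplus>\<^bsub>M\<^esub> y i" "(x \<triangleleft>\<^bsub>?S\<^esub> b) i = x i \<triangleleft>\<^bsub>M\<^esub> b"
    if "i \<in> ?I" for x y b i
    using that by (simp_all add: rmod_direct_sum_def)
  have add_closed: "x \<oplus>\<^bsub>?S\<^esub> y \<in> carrier ?S \<and> supp (x \<oplus>\<^bsub>?S\<^esub> y) \<subseteq> supp x \<union> supp y"
    if x: "x \<in> carrier ?S" and y: "y \<in> carrier ?S" for x y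
  proof -
    have s: "supp (x \<oplus>\<^bsub>?S\<^esub> y) \<subseteq> supp x \<union> supp y"
      by (auto simp: supp_def S_simps)
    then have "finite (supp (x \<oplus>\<^bsub>?S\<^esub> y))"
      using supp_fin[OF x] supp_fin[OF y] by (meson finite_UnI finite_subset)
    moreover have "x i \<oplus>\<^bsub>M\<^esub> y i \<in> carrier (?F i)" if "i \<in> ?I" for i
      using F[OF that] val[OF x that] val[OF y that]
      by (metis \<open>\<And>i. add (?F i) = add M\<close> abelian_groupE(1) right_module_def)
    ultimately show ?thesis
      using s by (simp add: rmod_direct_sum_def supp_def)
  qed
  have smult_closed: "x \<triangleleft>\<^bsub>?S\<^esub> b \<in> carrier ?S \<and> supp (x \<triangleleft>\<^bsub>?S\<^esub> b) \<subseteq> supp x"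
    if x: "x \<in> carrier ?S" and b: "b \<in> carrier B" for x b
  proof -
    have s: "supp (x \<triangleleft>\<^bsub>?S\<^esub> b) \<subseteq> supp x"
      using b by (auto simp: supp_def S_simps rsmult_zero_left)
    then have "finite (supp (x \<triangleleft>\<^bsub>?S\<^esub> b))"
      using supp_fin[OF x] by (meson finite_subset)
    moreover have "x i \<triangleleft>\<^bsub>M\<^esub> b \<in> carrier (?F i)" if "i \<in> ?I" for i
      using right_module.rsmult_closed[OF F[OF that] val[OF x that] b] by simp
    ultimately show ?thesis
      using s by (simp add: rmod_direct_sum_def supp_def)
  qed
  have g_add: "g (x \<oplus>\<^bsub>?S\<^esub> y) = g x \<oplus>\<^bsub>M\<^esub> g y" if x: "x \<in> carrier ?S" and y: "y \<in> carrier ?S" for x y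
  proof -
    let ?A = "supp x \<union> supp y"
    have A: "finite ?A" "?A \<subseteq> ?I"
      using supp_fin x y by (auto simp: supp_def)
    have "g (x \<oplus>\<^bsub>?S\<^esub> y) = finsum M (x \<oplus>\<^bsub>?S\<^esub> y) ?A"
      using add_closed[OF x y] A by (intro g_eq) auto
    also have "\<dots> = finsum M (\<lambda>i. x i \<oplus>\<^bsub>M\<^esub> y i) ?A"
      using A(2) xc[OF x] xc[OF y] by (intro M.finsum_cong') (auto simp: S_simps)
    also have "\<dots> = finsum M x ?A \<oplus>\<^bsub>M\<^esub> finsum M y ?A"
      using A(2) xc[OF x] xc[OF y] by (intro M.finsum_addf) auto
    also have "\<dots> = g x \<oplus>\<^bsub>M\<^esub> g y"
      using g_eq[OF x, of ?A] g_eq[OF y, of ?A] A by simp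
    finally show ?thesis .
  qed
  have g_smult: "g (x \<triangleleft>\<^bsub>?S\<^esub> b) = g x \<triangleleft>\<^bsub>M\<^esub> b" if x: "x \<in> carrier ?S" and b: "b \<in> carrier B" for x b
  proof -
    have A: "finite (supp x)" "supp x \<subseteq> ?I"
      using supp_fin x by (auto simp: supp_def)
    have "g (x \<triangleleft>\<^bsub>?S\<^esub> b) = finsum M (x \<triangleleft>\<^bsub>?S\<^esub> b) (supp x)"
      using smult_closed[OF x b] A by (intro g_eq) auto
    also have "\<dots> = finsum M (\<lambda>i. x i \<triangleleft>\<^bsub>M\<^esub> b) (supp x)"
      using A(2) xc[OF x] b by (intro M.finsum_cong') (auto simp: S_simps rsmult_closed)
    also have "\<dots> = g x \<triangleleft>\<^bsub>M\<^esub> b"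
      using A xc[OF x] x b by (subst finsum_rsmult[symmetric]) (auto simp: g_def)
    finally show ?thesis .
  qed
  have g_Hom: "g \<in> rmod_Hom B ?S M"
  proof -
    have "g \<in> extensional (carrier ?S)" by (simp add: g_def)
    then show ?thesis
      using g_closed g_add g_smult by (auto simp: rmod_Hom_def hom_def)
  qed
  have "m \<in> g ` carrier ?S" if m: "m \<in> carrier M" for m
  proof -
    \<comment> \<open>The only possibly nonzero coordinate sits at index \<open>m\<close> and has
      value \<open>m\<close>; hence its coordinate sum is \<open>m\<close>.\<close>
    let ?x = "direct_sum_inj ?I ?F m m"
    have x: "?x \<in> carrier ?S"
      using direct_sum_inj_closed[of ?I B ?F, OF F m cyclic_submodule_mem[OF m]] .
    have "g ?x = finsum M ?x {m}"
      using m by (intro g_eq x) (auto simp: supp_def direct_sum_inj_def)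
    also have "\<dots> = m"
      using m by (simp add: direct_sum_inj_def)
    finally show ?thesis using x by (metis imageI)
  qed
  then have surj: "surjection_from_direct_sum B {N. cyclic_right_module B N} M ?I ?F g"
    using g_Hom g_closed cyclic_submodule_cyclic
    by (auto simp: surjection_from_direct_sum_def)
  show ?thesis
    \<comment> \<open>The family is indexed by elements of \<open>M\<close>, whereas
      \<open>generated_by\<close> fixes an index type of pairs; the reindexing lemma bridges the
      two.\<close>
    by (rule generated_by_any_index[OF _ _ surj])
      (simp_all add: cyclic_right_module_def right_module_axioms)
qed

text \<open>A local unit for the submodule generated by \<open>f n\<close>, with \<open>n\<close> a
  generator of \<open>N\<close>, suffices: f(nb)e = (f(n)b)e = (f(n)e)b = f(n)b = f(nb).\<close>

lemma (in right_R_module) cyclic_Hom_unit: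
  assumes units: "has_right_local_units B R M"
    and N: "cyclic_right_module B N" and f: "f \<in> rmod_Hom B N M"
  shows "\<exists>e \<in> centralizing_elements B R. f = compose (carrier N) (right_mult_map M e) f"
proof -
  obtain n where n: "n \<in> carrier N" "carrier N = (\<lambda>b. n \<triangleleft>\<^bsub>N\<^esub> b) ` carrier B"
    using N by (auto simp: cyclic_right_module_def)
  have fc: "f x \<in> carrier M" if "x \<in> carrier N" for x
    using f that by (auto simp: rmod_Hom_def hom_def)
  have "fg_right_submodule B M (right_submodule B M hull {f n})"
    using fc[OF n(1)] unfolding fg_right_submodule_def by (intro exI[of _ "{f n}"]) simp
  then obtain e where e: "e \<in> centralizing_elements B R" "f n \<bullet>\<^bsub>M\<^esub> e = f n"
    using units hull_subset[of "{f n}" "right_submodule B M"]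
    unfolding has_right_local_units_def by blast
  have "f x \<bullet>\<^bsub>M\<^esub> e = f x" if "x \<in> carrier N" for x
  proof -
    obtain b where b: "b \<in> carrier B" "x = n \<triangleleft>\<^bsub>N\<^esub> b"
      using \<open>x \<in> carrier N\<close>[unfolded n(2)] by (elim imageE)
    then have "f x = f n \<triangleleft>\<^bsub>M\<^esub> b"
      using f n(1) by (auto simp: rmod_Hom_def)
    then show ?thesis
      using e b fc[OF n(1)] by (simp add: ract_rsmult_centralizing)
  qed
  then have "f = compose (carrier N) (right_mult_map M e) f"
    \<comment> \<open>Both maps are extensional on \<open>carrier N\<close>, so agreement of values
      there gives equality.\<close>
    using f fc by (intro extensionalityI[of _ "carrier N"])
      (auto simp: rmod_Hom_def compose_def right_mult_map_def)
  then show ?thesis using e by blast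
qed

theorem theorem2p3:
  fixes B :: "('b, 'x) ring_scheme"
    and R :: "('b, 'r, 'y) bring_scheme"
    and \<M> :: "('b, 'r, 'u) Rmod set"
  assumes "ring B"
    and "nonunital_B_ring B R"
    and "\<forall>M \<in> \<M>. right_R_module B R M"
  shows "(\<forall>M \<in> \<M>. has_right_local_units B R M) \<longleftrightarrow>
    (\<exists>\<N> :: ('b, 'u) rmod set.
       (\<forall>N \<in> \<N>. right_module B N) \<and>
       (\<forall>M \<in> \<M>. generated_by B \<N> M) \<and>
       (\<forall>N \<in> \<N>. \<forall>M \<in> \<M>. \<forall>f \<in> rmod_Hom B N M.
          \<exists>e \<in> centralizing_elements B R. f = compose (carrier N) (right_mult_map M e) f))"
proof
  assume units: "\<forall>M \<in> \<M>. has_right_local_units B R M"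
  \<comment> \<open>A single \<N> serves all of \<M>: the cyclic modules on the common carrier type
    \<open>'u\<close> include the cyclic submodules of every \<open>M\<close>.\<close>
  have "generated_by B {N :: ('b, 'u) rmod. cyclic_right_module B N} M" if "M \<in> \<M>" for M
  proof -
    interpret right_R_module B R M using assms(3) that by blast
    show ?thesis by (rule M.generated_by_cyclic)
  qed
  moreover have "\<exists>e \<in> centralizing_elements B R. f = compose (carrier N) (right_mult_map M e) f"
    if "cyclic_right_module B N" "M \<in> \<M>" "f \<in> rmod_Hom B N M" for N :: "('b, 'u) rmod" and M f
    using that units assms(3) by (intro right_R_module.cyclic_Hom_unit) blast+
  ultimately show "\<exists>\<N> :: ('b, 'u) rmod set.
       (\<forall>N \<in> \<N>. right_module B N) \<and>
       (\<forall>M \<in> \<M>. generated_by B \<N> M) \<and>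
       (\<forall>N \<in> \<N>. \<forall>M \<in> \<M>. \<forall>f \<in> rmod_Hom B N M.
          \<exists>e \<in> centralizing_elements B R. f = compose (carrier N) (right_mult_map M e) f)"
    unfolding cyclic_right_module_def
    \<comment> \<open>The definition is unfolded inside the witness too, so that it matches the
      unfolded facts.\<close>
    by (intro exI[of _ "{N. cyclic_right_module B N}", unfolded cyclic_right_module_def]) blast
next
  assume "\<exists>\<N> :: ('b, 'u) rmod set.
       (\<forall>N \<in> \<N>. right_module B N) \<and>
       (\<forall>M \<in> \<M>. generated_by B \<N> M) \<and>
       (\<forall>N \<in> \<N>. \<forall>M \<in> \<M>. \<forall>f \<in> rmod_Hom B N M.
          \<exists>e \<in> centralizing_elements B R. f = compose (carrier N) (right_mult_map M e) f)"
  then obtain \<N> :: "('b, 'u) rmod set" where \<N>: "\<forall>N \<in> \<N>. right_module B N"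
      "\<forall>M \<in> \<M>. generated_by B \<N> M"
      "\<forall>N \<in> \<N>. \<forall>M \<in> \<M>. \<forall>f \<in> rmod_Hom B N M.
          \<exists>e \<in> centralizing_elements B R. f = compose (carrier N) (right_mult_map M e) f"
    by blast
  show "\<forall>M \<in> \<M>. has_right_local_units B R M"
  proof
    fix M assume "M \<in> \<M>"
    then show "has_right_local_units B R M"
      using \<N> assms(3) by (intro right_R_module.local_units_if_generated[where \<N> = \<N>]) blast+
  qed
qed

end
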